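(* Let $\{P_n(z)\}$ be a polynomial sequence whose generating function is $$\sum_{n=0}^{\infty}P_n(z)t^n=\frac{1}{1+B(z)t^2+A(z)t^3},$$ where $B(z)$ and $A(z)$ are polynomials in $z$ with complex coefficients. Given any $n\in\mathbb{N}$, those zeros $z$ of $P_n(z)$ for which $A(z)B(z)\neq 0$ lie on the curve defined by $$\Im\left(\frac{B^3(z)}{A^2(z)}\right)=0\qquad\text{and}\qquad 0\le \Re\left(\frac{B^3(z)}{A^2(z)}\right)<\infty .$$
   Context: The generating function identity is an identity of power series in $t$ whose coefficients are polynomials in the complex variable $z$. $\Re$ and $\Im$ denote real and imaginary parts, $B^3(z)=(B(z))^3$ and $A^2(z)=(A(z))^2$.
   Formalization: The index n = 1 is excluded: P_1 is identically zero, so every z is a zero of it and the claim fails there, e.g. for A = 1, B = z, z = 1+i, where B^3/A^2 = -2+2i is not real. *)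

theory Defs
  imports Complex_Main "HOL-Computational_Algebra.Computational_Algebra"
begin

end

theory Submission imports Defs begin

text \<open>
  Fix \<open>z\<close> and write \<open>a = A(z)\<close>, \<open>b = B(z)\<close>, \<open>x = a\<^sup>2 / (- b)\<^sup>3\<close>. Up to nonzero factors, the values
  \<open>P\<^bsub>2m\<^esub>(z)\<close> and \<open>P\<^bsub>2m+1\<^esub>(z)\<close> are numbers \<open>u\<^sub>m\<close> and \<open>v\<^sub>m\<close> with
  \<open>u\<^bsub>m+2\<^esub> = u\<^bsub>m+1\<^esub> + x v\<^sub>m\<close> and \<open>v\<^bsub>m+1\<^esub> = v\<^sub>m + u\<^sub>m\<close>. If \<open>x\<close> lies in the open upper half-plane, then the
  arguments satisfy, for \<open>m \<ge> 1\<close>, \<open>arg v\<^sub>m \<le> arg v\<^bsub>m+1\<^esub> \<le> arg u\<^bsub>m+1\<^esub> \<le> arg v\<^sub>m + arg x\<close>: this is preserved by the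
  recurrence, and it keeps all three numbers in a sector of opening less than \<open>\<pi>\<close>, where sums
  do not cancel. The lower half-plane is symmetric, and for \<open>x > 0\<close> all terms are positive. Hence a zero forces \<open>x\<close> to be a negative real, and \<open>x = - 1 / (b\<^sup>3 / a\<^sup>2)\<close>.
\<close>

lemma fps_inverse_cubic_recurrence:
  fixes A B :: "'a::comm_ring_1"
  assumes "Abs_fps P * (1 + fps_const B * fps_X ^ 2 + fps_const A * fps_X ^ 3) = 1"
  shows "P 0 = 1" "P 1 = 0" "P 2 = - B" "P (n + 3) = - B * P (n + 1) - A * P n"
proof -
  have coeff: "P k + (if k < 2 then 0 else B * P (k - 2)) + (if k < 3 then 0 else A * P (k - 3))
      = (if k = 0 then 1 else 0)" for k
  proof -
    have "Abs_fps P * (1 + fps_const B * fps_X ^ 2 + fps_const A * fps_X ^ 3)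
        = Abs_fps P + fps_const B * (Abs_fps P * fps_X ^ 2) + fps_const A * (Abs_fps P * fps_X ^ 3)"
      by (simp add: algebra_simps)
    with assms have "fps_nth (Abs_fps P + fps_const B * (Abs_fps P * fps_X ^ 2)
        + fps_const A * (Abs_fps P * fps_X ^ 3)) k = fps_nth 1 k"
      by simp
    then show ?thesis
      by (auto simp: fps_X_power_mult_right_nth split: if_splits)
  qed
  show P0: "P 0 = 1" and "P 1 = 0"
    using coeff[of 0] coeff[of 1] by simp_all
  show "P 2 = - B"
    using coeff[of 2] P0 by (simp add: eq_neg_iff_add_eq_0)
  have "P (n + 3) + B * P (n + 1) + A * P n = 0"
    using coeff[of "n + 3"] by (simp add: numeral_eq_Suc)
  then show "P (n + 3) = - B * P (n + 1) - A * P n"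
    by (simp add: algebra_simps eq_neg_iff_add_eq_0)
qed

text \<open>
  The sign of \<open>Im (cnj s * t)\<close> says on which side of \<open>s\<close> the number \<open>t\<close> lies. The factor \<open>Im x\<close>
  treats both half-planes at once. The inequalities are redundant as conditions on arguments, but
  in this form each one follows from the previous ones by bilinearity.
\<close>

definition sector_ordered :: "complex \<Rightarrow> complex \<Rightarrow> complex \<Rightarrow> complex \<Rightarrow> bool" where
  "sector_ordered x p q r \<longleftrightarrow>
     0 \<le> Im x * Im (cnj p * q) \<and> 0 \<le> Im x * Im (cnj p * r) \<and> 0 \<le> Im x * Im (cnj q * r) \<and>
     0 \<le> Im x * Im (cnj q * (x * p)) \<and> 0 \<le> Im x * Im (cnj r * (x * p)) \<and>
     0 \<le> Im x * Im (cnj r * (x * q))"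

lemma Im_cnj_mult_self: "Im x * Im (cnj p * (x * p)) = (Im x)\<^sup>2 * (cmod p)\<^sup>2"
  unfolding cmod_power2 by (simp add: power2_eq_square algebra_simps)

lemma Im_cnj_mult_scaled: "Im (cnj (x * p) * (x * q)) = (cmod x)\<^sup>2 * Im (cnj p * q)"
  unfolding cmod_power2 by (simp add: power2_eq_square algebra_simps)

text \<open>Expanding each new inequality bilinearly leaves only old ones, zero self-pairings,
  pairings of a number with its own \<open>x\<close>-multiple, and old ones scaled by
  \<open>(cmod x)\<^sup>2\<close>.\<close>

lemma sector_ordered_step:
  assumes "sector_ordered x p q r"
  shows "sector_ordered x q (q + r) (r + x * p)"
proof -
  define s where "s p q = Im x * Im (cnj p * q)" for p q
  have add: "s (p + p') q = s p q + s p' q" "s p (q + q') = s p q + s p q'" for p p' q q'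
    by (simp_all add: s_def algebra_simps)
  have self: "s p p = 0" for p
    by (simp add: s_def)
  have rot: "s p (x * p) \<ge> 0" for p
    unfolding s_def Im_cnj_mult_self by simp
  have scaled: "s (x * p) (x * q) = (cmod x)\<^sup>2 * s p q" for p q
    unfolding s_def Im_cnj_mult_scaled by simp
  have ordered_iff: "sector_ordered x p q r \<longleftrightarrow>
      0 \<le> s p q \<and> 0 \<le> s p r \<and> 0 \<le> s q r \<and> 0 \<le> s q (x * p) \<and> 0 \<le> s r (x * p) \<and> 0 \<le> s r (x * q)"
    for p q r
    by (simp only: sector_ordered_def s_def)
  from assms show ?thesis
    unfolding ordered_iff by (auto simp: add self rot scaled distrib_left)
qed

text \<open>Cancellation would give \<open>r = - q\<close> or \<open>r = - (x * p)\<close>. Since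
  \<open>x * q\<close> and \<open>x * p\<close> lie strictly to one side of \<open>q\<close> and
  \<open>p\<close>, this reverses the sign of a sector inequality.\<close>

lemma sector_ordered_sum_nonzero:
  assumes "sector_ordered x p q r" "Im x \<noteq> 0"
  shows "q \<noteq> 0 \<Longrightarrow> q + r \<noteq> 0" and "p \<noteq> 0 \<Longrightarrow> r + x * p \<noteq> 0"
proof -
  have pos: "Im x * Im (cnj p * (x * p)) > 0" if "p \<noteq> 0" for p
    unfolding Im_cnj_mult_self using that assms(2) by simp
  show "q + r \<noteq> 0" if "q \<noteq> 0"
  proof
    assume "q + r = 0"
    then have "r = - q"
      by (simp add: eq_neg_iff_add_eq_0 add.commute)
    then have "Im x * Im (cnj r * (x * q)) = - (Im x * Im (cnj q * (x * q)))"
      by (simp add: algebra_simps)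
    with pos[OF that] assms(1) show False
      unfolding sector_ordered_def by linarith
  qed
  show "r + x * p \<noteq> 0" if "p \<noteq> 0"
  proof
    assume "r + x * p = 0"
    then have "r = - (x * p)"
      by (simp add: eq_neg_iff_add_eq_0)
    then have "Im x * Im (cnj p * r) = - (Im x * Im (cnj p * (x * p)))"
      by (simp add: algebra_simps)
    with pos[OF that] assms(1) show False
      unfolding sector_ordered_def by linarith
  qed
qed

lemma coupled_recurrence_nonzero:
  fixes u v :: "nat \<Rightarrow> complex"
  assumes init: "u 0 = 1" "u 1 = 1" "v 0 = 0"
    and u: "\<And>m. u (m + 2) = u (m + 1) + x * v m"
    and v: "\<And>m. v (m + 1) = v m + u m"
    and x: "Im x \<noteq> 0 \<or> Re x > 0"
  shows "u m \<noteq> 0" and "v (m + 1) \<noteq> 0"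
proof -
  have v1: "v 1 = 1" and v2: "v 2 = 2" and u2: "u 2 = 1"
    using v[of 0] v[of 1] u[of 0] init by (simp_all add: numeral_2_eq_2)
  have next_u: "u (Suc m + 2) = u (m + 2) + x * v (m + 1)"
    and next_v: "v (Suc m + 2) = v (m + 2) + u (m + 2)" for m
    using u[of "Suc m"] v[of "m + 2"] by simp_all
  \<comment> \<open>The induction starts at \<open>v 1\<close> because
    \<open>v 0 = 0\<close>.\<close>
  have tail: "v (m + 1) \<noteq> 0 \<and> v (m + 2) \<noteq> 0 \<and> u (m + 2) \<noteq> 0" for m
  proof (cases "Im x = 0")
    case True
    with x have "Re x > 0"
      by simp
    have "v (m + 1) \<in> \<real> \<and> Re (v (m + 1)) > 0 \<and> v (m + 2) \<in> \<real> \<and> Re (v (m + 2)) > 0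
        \<and> u (m + 2) \<in> \<real> \<and> Re (u (m + 2)) > 0"
    proof (induction m)
      case 0
      show ?case
        using v1 v2 u2 by (simp add: numeral_2_eq_2)
    next
      case (Suc m)
      with True \<open>Re x > 0\<close> show ?case
        unfolding next_u next_v by (auto simp: complex_is_Real_iff intro!: add_pos_pos)
    qed
    then show ?thesis
      by auto
  next
    case False
    have "sector_ordered x (v (m + 1)) (v (m + 2)) (u (m + 2))
        \<and> v (m + 1) \<noteq> 0 \<and> v (m + 2) \<noteq> 0 \<and> u (m + 2) \<noteq> 0"
    proof (induction m)
      case 0
      show ?case
        using v1 v2 u2 by (simp add: sector_ordered_def numeral_2_eq_2)
    next
      case (Suc m)
      then have "sector_ordered x (v (m + 1)) (v (m + 2)) (u (m + 2))"
        by blast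
      from sector_ordered_step[OF this] sector_ordered_sum_nonzero[OF this False] Suc
      show ?case
        unfolding next_u next_v by simp
    qed
    then show ?thesis
      by blast
  qed
  show "v (m + 1) \<noteq> 0"
    using tail by blast
  show "u m \<noteq> 0"
  proof (cases "m < 2")
    case True
    then have "m = 0 \<or> m = 1"
      by auto
    then show ?thesis
      using init by auto
  next
    case False
    then obtain k where "m = k + 2"
      by (metis add.commute le_Suc_ex not_less)
    then show ?thesis
      using tail by blast
  qed
qed

lemma three_term_recurrence_nonzero:
  fixes p :: "nat \<Rightarrow> complex"
  assumes init: "p 0 = 1" "p 1 = 0" "p 2 = - b"
    and rec: "\<And>n. p (n + 3) = - b * p (n + 1) - a * p n"
    and nz: "a \<noteq> 0" "b \<noteq> 0"
    and x: "Im (a ^ 2 / (- b) ^ 3) \<noteq> 0 \<or> Re (a ^ 2 / (- b) ^ 3) > 0"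
    and n: "n \<noteq> 1"
  shows "p n \<noteq> 0"
proof -
  define u where "u m = p (2 * m) / (- b) ^ m" for m
  \<comment> \<open>The factor \<open>b / a\<close> makes the coupling in
    \<open>v (m + 1) = v m + u m\<close> equal to 1, so \<open>a\<close> and \<open>b\<close> enter
    only through \<open>x\<close>.\<close>
  define v where "v m = b * p (2 * m + 1) / (a * (- b) ^ m)" for m
  have "u 0 = 1" "u 1 = 1" "v 0 = 0"
    using init nz by (simp_all add: u_def v_def)
  moreover have "u (m + 2) = u (m + 1) + a ^ 2 / (- b) ^ 3 * v m" for m
  proof -
    have "p (2 * (m + 2)) = - b * p (2 * (m + 1)) - a * p (2 * m + 1)"
      using rec[of "2 * m + 1"] by (simp add: numeral_eq_Suc)
    then have "u (m + 2) = (- b * p (2 * (m + 1)) - a * p (2 * m + 1)) / (- b) ^ (m + 2)"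
      by (simp only: u_def)
    also have "\<dots> = u (m + 1) + a ^ 2 / (- b) ^ 3 * v m"
      unfolding u_def v_def using nz
      by (simp add: field_simps power2_eq_square power3_eq_cube)
    finally show ?thesis .
  qed
  moreover have "v (m + 1) = v m + u m" for m
  proof -
    have "p (2 * (m + 1) + 1) = - b * p (2 * m + 1) - a * p (2 * m)"
      using rec[of "2 * m"] by (simp add: numeral_eq_Suc)
    then have "v (m + 1) = b * (- b * p (2 * m + 1) - a * p (2 * m)) / (a * (- b) ^ (m + 1))"
      by (simp only: v_def)
    also have "\<dots> = v m + u m"
      unfolding u_def v_def using nz by (simp add: field_simps)
    finally show ?thesis .
  qed
  ultimately have nonzero: "u m \<noteq> 0" "v (m + 1) \<noteq> 0" for m
    using coupled_recurrence_nonzero[of u v "a ^ 2 / (- b) ^ 3", OF _ _ _ _ _ x] by blast+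
  show ?thesis
  proof (cases "even n")
    case True
    then obtain m where "n = 2 * m" ..
    then show ?thesis
      using nonzero(1)[of m] by (auto simp: u_def)
  next
    case False
    then obtain m where "n = 2 * m + 1"
      by (rule oddE)
    \<comment> \<open>Excluding \<open>n = 1\<close> excludes \<open>v 0\<close>, the one vanishing
      term.\<close>
    with n obtain k where "n = 2 * (k + 1) + 1"
      by (cases m) auto
    then show ?thesis
      using nonzero(2)[of k] nz by (auto simp: v_def)
  qed
qed

theorem theorem8:
  fixes A B :: "complex poly" and P :: "nat \<Rightarrow> complex poly"
    and n :: nat and z :: complex
  assumes gf: "Abs_fps P * (1 + fps_const B * fps_X ^ 2 + fps_const A * fps_X ^ 3) = 1"
    and n: "n \<noteq> 1"
    and zero: "poly (P n) z = 0"
    and nz: "poly A z * poly B z \<noteq> 0"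
  shows "Im (poly B z ^ 3 / poly A z ^ 2) = 0 \<and> 0 \<le> Re (poly B z ^ 3 / poly A z ^ 2)"
proof (rule ccontr)
  define a b where "a = poly A z" and "b = poly B z"
  define w where "w = b ^ 3 / a ^ 2"
  assume "\<not> ?thesis"
  then have w: "Im w \<noteq> 0 \<or> Re w < 0"
    unfolding w_def a_def b_def by linarith
  have ab: "a \<noteq> 0" "b \<noteq> 0"
    using nz by (simp_all add: a_def b_def)
  have "a ^ 2 / (- b) ^ 3 = - inverse w"
    by (simp add: w_def)
  \<comment> \<open>This is the denominator in the real and imaginary parts of
    \<open>inverse w\<close>.\<close>
  moreover have "(Re w)\<^sup>2 + (Im w)\<^sup>2 > 0"
    using w by (auto simp: sum_power2_gt_zero_iff)
  ultimately have "Im (a ^ 2 / (- b) ^ 3) \<noteq> 0 \<or> Re (a ^ 2 / (- b) ^ 3) > 0"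
    using w by (auto simp: divide_less_0_iff)
  moreover note rec = fps_inverse_cubic_recurrence[OF gf]
  have "poly (P 0) z = 1" "poly (P 1) z = 0" "poly (P 2) z = - b"
    by (simp_all only: rec b_def poly_1 poly_0 poly_minus)
  moreover have "poly (P (k + 3)) z = - b * poly (P (k + 1)) z - a * poly (P k) z" for k
    unfolding rec(4) by (simp add: a_def b_def)
  ultimately have "poly (P n) z \<noteq> 0"
    using three_term_recurrence_nonzero[of "\<lambda>k. poly (P k) z" b a n] ab n by blast
  with zero show False
    by contradiction
qed

end
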